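(* Let $\mathrm{H}:\mathbf{Top}_0\to\mathbf{Set}$ be an R-subset system and $\{X_i:1\le i\le n\}$ a finite family of $T_0$ spaces. Then $\left(\prod_{i=1}^{n}X_i\right)^h=\prod_{i=1}^{n}X_i^h$ (up to homeomorphism), where $X^h$ denotes the $\mathrm{H}$-sobrification of a $T_0$ space $X$.
   Context: $\mathbf{Top}_0$ is the category of all $T_0$ spaces with continuous mappings. A subset $A$ of a space $X$ is irreducible if it is nonempty and whenever $A\subseteq F_1\cup F_2$ with $F_1,F_2$ closed in $X$, then $A\subseteq F_1$ or $A\subseteq F_2$. An R-subset system (irreducible subset system) is a covariant functor $\mathrm{H}:\mathbf{Top}_0\to\mathbf{Set}$ such that (i) for every $T_0$ space $X$, $\mathrm{H}(X)$ is a set of irreducible subsets of $X$ which contains all singletons $\{x\}$, $x\in X$; (ii) for every continuous mapping $f:X\to Y$ between $T_0$ spaces and every $A\in \mathrm{H}(X)$, $\mathrm{H}(f)(A)=f(A)\in \mathrm{H}(Y)$. A $T_0$ space $X$ is $\mathrm{H}$-sober if for every $A\in\mathrm{H}(X)$ there is a (necessarily unique) point $x\in X$ with $\overline{A}=\overline{\{x\}}$. The $\mathrm{H}$-sobrification of a $T_0$ space $X$ is an $\mathrm{H}$-sober space $X^h$ together with a continuous $\mu:X\to X^h$ such that for every continuous mapping $f:X\to Y$ to an $\mathrm{H}$-sober space $Y$ there is a unique continuous $f^*:X^h\to Y$ with $f^*\circ\mu=f$; it is unique up to homeomorphism. It always exists and is realized as follows: a subset $A\subseteq X$ is $\mathrm{H}$-sober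 determined if for every continuous $f:X\to Y$ to an $\mathrm{H}$-sober space $Y$ there exists a unique $y_A\in Y$ with $\overline{f(A)}=\overline{\{y_A\}}$; $X^h$ is the set $\mathrm{H}^d_c(X)$ of all closed $\mathrm{H}$-sober determined subsets of $X$ with the topology having as subbase the sets $\Diamond U=\{A\in\mathrm{H}^d_c(X):A\cap U\ne\emptyset\}$, $U$ open in $X$, and $\mu(x)=\overline{\{x\}}$. *)

theory Defs
  imports "HOL-Analysis.Analysis"
begin

text \<open>
  \<open>Top\<^sub>0\<close> is rendered as the collection of all \<open>T\<^sub>0\<close> topologies whose carrier is an arbitrary
  subset of a type \<open>'u\<close>, with continuous maps between them.  The type variable \<open>'u\<close> plays the role
  of the universe of sets and is left completely arbitrary; no closure properties are imposed on it.
\<close>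

definition irreducible_in :: "'u topology \<Rightarrow> 'u set \<Rightarrow> bool" where
  "irreducible_in X A \<longleftrightarrow> A \<subseteq> topspace X \<and> A \<noteq> {} \<and>
     (\<forall>F1 F2. closedin X F1 \<and> closedin X F2 \<and> A \<subseteq> F1 \<union> F2 \<longrightarrow> A \<subseteq> F1 \<or> A \<subseteq> F2)"

text \<open>
  Only the object part \<open>H\<close> of the functor is a parameter: its action on a morphism \<open>f\<close> is prescribed
  to be \<open>A \<mapsto> f ` A\<close>, for which the functor laws hold automatically.
  Values of \<open>H\<close> on spaces that are not \<open>T\<^sub>0\<close> are irrelevant.
\<close>

definition R_subset_system :: "('u topology \<Rightarrow> 'u set set) \<Rightarrow> bool" where
  "R_subset_system H \<longleftrightarrow>
     (\<forall>X. t0_space X \<longrightarrow> (\<forall>A \<in> H X. irreducible_in X A) \<and> (\<forall>x \<in> topspace X. {x} \<in> H X)) \<and>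
     (\<forall>X Y f A. t0_space X \<and> t0_space Y \<and> continuous_map X Y f \<and> A \<in> H X \<longrightarrow> f ` A \<in> H Y)"

definition H_sober :: "('u topology \<Rightarrow> 'u set set) \<Rightarrow> 'u topology \<Rightarrow> bool" where
  "H_sober H X \<longleftrightarrow> t0_space X \<and>
     (\<forall>A \<in> H X. \<exists>!x. x \<in> topspace X \<and> X closure_of A = X closure_of {x})"

text \<open>
  A map out of \<open>Xh\<close> is a total function on \<open>'u\<close>; restricting to extensional ones makes
  uniqueness mean uniqueness as a map on \<open>topspace Xh\<close>.
\<close>

definition H_sobrification ::
  "('u topology \<Rightarrow> 'u set set) \<Rightarrow> 'u topology \<Rightarrow> 'u topology \<Rightarrow> ('u \<Rightarrow> 'u) \<Rightarrow> bool" where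
  "H_sobrification H X Xh \<mu> \<longleftrightarrow> H_sober H Xh \<and> continuous_map X Xh \<mu> \<and>
     (\<forall>Y f. H_sober H Y \<and> continuous_map X Y f \<longrightarrow>
       (\<exists>!g. g \<in> extensional (topspace Xh) \<and> continuous_map Xh Y g \<and>
             (\<forall>x \<in> topspace X. g (\<mu> x) = f x)))"

text \<open>
  The rest of this theory shows that the universal property is realized by the closed \<open>H\<close>-sober
  determined sets, provided \<open>'u\<close> is large enough to hold a copy of that space; in particular
  \<open>H\<close>-sobrifications exist for every \<open>X\<close> whose power set embeds into \<open>'u\<close>.
\<close>

definition H_sober_determined :: "('u topology \<Rightarrow> 'u set set) \<Rightarrow> 'u topology \<Rightarrow> 'u set \<Rightarrow> bool" where
  "H_sober_determined H X A \<longleftrightarrow> A \<subseteq> topspace X \<and>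
     (\<forall>Y f. H_sober H Y \<and> continuous_map X Y f \<longrightarrow>
       (\<exists>!y. y \<in> topspace Y \<and> Y closure_of (f ` A) = Y closure_of {y}))"

definition H_sober_closed :: "('u topology \<Rightarrow> 'u set set) \<Rightarrow> 'u topology \<Rightarrow> 'u set set" where
  "H_sober_closed H X = {A. closedin X A \<and> H_sober_determined H X A}"

definition H_sober_closed_space ::
  "('u topology \<Rightarrow> 'u set set) \<Rightarrow> 'u topology \<Rightarrow> 'u set topology" where
  "H_sober_closed_space H X =
     topology_generated_by {{A \<in> H_sober_closed H X. A \<inter> U \<noteq> {}} | U. openin X U}"

lemma closure_of_eq_iff_meets:
  assumes "A \<subseteq> topspace X" "B \<subseteq> topspace X"
  shows "X closure_of A = X closure_of B \<longleftrightarrow>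
         (\<forall>U. openin X U \<longrightarrow> (A \<inter> U \<noteq> {} \<longleftrightarrow> B \<inter> U \<noteq> {}))"
proof
  assume eq: "X closure_of A = X closure_of B"
  show "\<forall>U. openin X U \<longrightarrow> (A \<inter> U \<noteq> {} \<longleftrightarrow> B \<inter> U \<noteq> {})"
    by (metis eq inf_commute openin_Int_closure_of_eq_empty)
next
  assume "\<forall>U. openin X U \<longrightarrow> (A \<inter> U \<noteq> {} \<longleftrightarrow> B \<inter> U \<noteq> {})"
  then show "X closure_of A = X closure_of B"
    unfolding closure_of_def by blast
qed

lemma closure_of_eq_sing_iff:
  assumes "A \<subseteq> topspace X" "x \<in> topspace X"
  shows "X closure_of A = X closure_of {x} \<longleftrightarrow>
         (\<forall>U. openin X U \<longrightarrow> (A \<inter> U \<noteq> {} \<longleftrightarrow> x \<in> U))"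
  using closure_of_eq_iff_meets[of A X "{x}"] assms by auto

lemma t0_space_closure_sing_unique:
  assumes "t0_space X" "x \<in> topspace X" "y \<in> topspace X" "X closure_of {x} = X closure_of {y}"
  shows "x = y"
  using assms by (simp add: t0_space_closure_of_sing)

lemma H_soberI:
  assumes "t0_space X"
    and "\<And>A. A \<in> H X \<Longrightarrow> \<exists>x \<in> topspace X. X closure_of A = X closure_of {x}"
  shows "H_sober H X"
  unfolding H_sober_def using assms t0_space_closure_sing_unique by metis

lemma H_sober_determinedI:
  assumes "A \<subseteq> topspace X"
    and "\<And>Y f. \<lbrakk>H_sober H Y; continuous_map X Y f\<rbrakk>
           \<Longrightarrow> \<exists>y \<in> topspace Y. Y closure_of (f ` A) = Y closure_of {y}"
  shows "H_sober_determined H X A"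
  unfolding H_sober_determined_def
  using assms t0_space_closure_sing_unique H_sober_def by metis

locale sober_realization =
  fixes H :: "'u topology \<Rightarrow> 'u set set" and X Xh :: "'u topology"
    and \<phi> :: "'u set \<Rightarrow> 'u" and \<psi> :: "'u \<Rightarrow> 'u set"
  assumes H: "R_subset_system H" and X: "t0_space X"
    and hom: "homeomorphic_maps (H_sober_closed_space H X) Xh \<phi> \<psi>"
begin

abbreviation "D \<equiv> H_sober_closed H X"
abbreviation "S \<equiv> H_sober_closed_space H X"
abbreviation "dia U \<equiv> {A \<in> D. A \<inter> U \<noteq> {}}"

lemma D_nonempty:
  assumes "A \<in> D" shows "A \<noteq> {}"
proof
  assume "A = {}"
  with assms have sd: "H_sober_determined H X {}" by (simp add: H_sober_closed_def)
  show False
  proof (cases "topspace X = {}")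
    case True
    have "H_sober H X"
      using H X True unfolding R_subset_system_def irreducible_in_def
      by (intro H_soberI) auto
    then show False
      using sd True unfolding H_sober_determined_def by (metis continuous_map_id empty_iff)
  next
    case False
    then obtain x where "x \<in> topspace X" by blast
    let ?Y = "discrete_topology {x}"
    have "A = {x}" if "A \<in> H ?Y" for A
    proof -
      have "A \<subseteq> {x}" "A \<noteq> {}"
        using H that t0_space_discrete_topology unfolding R_subset_system_def irreducible_in_def
        by (metis topspace_discrete_topology)+
      then show ?thesis by blast
    qed
    then have "H_sober H ?Y"
      by (intro H_soberI) (auto simp: t0_space_discrete_topology)
    moreover have "continuous_map X ?Y (\<lambda>_. x)" by simp
    ultimately obtain y where y: "y \<in> topspace ?Y" "?Y closure_of {} = ?Y closure_of {y}"
      using sd unfolding H_sober_determined_def by (metis image_empty)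
    then show False by (simp add: closure_of)
  qed
qed

lemma D_subset: "A \<in> D \<Longrightarrow> A \<subseteq> topspace X"
  by (simp add: H_sober_closed_def closedin_subset)

lemma topspace_S: "topspace S = D"
proof -
  have "dia (topspace X) = D"
    using D_nonempty D_subset by blast
  moreover have "openin X (topspace X)" by simp
  ultimately show ?thesis
    unfolding H_sober_closed_space_def topology_generated_by_topspace by blast
qed

lemma openin_dia: "openin X U \<Longrightarrow> openin S (dia U)"
  unfolding H_sober_closed_space_def by (rule topology_generated_by_Basis) blast

lemma continuous_into_S:
  assumes "\<And>z. z \<in> topspace Z \<Longrightarrow> f z \<in> D"
    and "\<And>U. openin X U \<Longrightarrow> openin Z {z \<in> topspace Z. f z \<inter> U \<noteq> {}}"
  shows "continuous_map Z S f"
  unfolding H_sober_closed_space_def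
proof (rule continuous_on_generated_topo)
  fix W assume "W \<in> {dia U |U. openin X U}"
  then obtain U where U: "openin X U" "W = dia U" by blast
  have "f -` W \<inter> topspace Z = {z \<in> topspace Z. f z \<inter> U \<noteq> {}}"
    using assms(1) U(2) by auto
  then show "openin Z (f -` W \<inter> topspace Z)" using assms(2) U(1) by simp
next
  have "\<Union> {dia U |U. openin X U} = D"
    using topspace_S unfolding H_sober_closed_space_def topology_generated_by_topspace by simp
  then show "f ` topspace Z \<subseteq> \<Union> {dia U |U. openin X U}" using assms(1) by auto
qed

lemma up_closed:
  assumes "openin S W" "A \<in> W" "A \<subseteq> B" "B \<in> D"
  shows "B \<in> W"
proof -
  have "generate_topology_on {dia U |U. openin X U} W"
    using assms(1) unfolding H_sober_closed_space_def by (rule openin_topology_generated_by)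
  then show ?thesis using assms(2)
  proof (induction W)
    case (Basis W) then show ?case using assms(3,4) by auto
  qed auto
qed

definition ext :: "'u topology \<Rightarrow> ('u \<Rightarrow> 'u) \<Rightarrow> 'u set \<Rightarrow> 'u" where
  "ext Y f A = (THE y. y \<in> topspace Y \<and> Y closure_of (f ` A) = Y closure_of {y})"

context
  fixes Y :: "'u topology" and f :: "'u \<Rightarrow> 'u"
  assumes Y: "H_sober H Y" and f: "continuous_map X Y f"
begin

lemma ext:
  assumes "A \<in> D"
  shows "ext Y f A \<in> topspace Y" "Y closure_of (f ` A) = Y closure_of {ext Y f A}"
proof -
  have "\<exists>!y. y \<in> topspace Y \<and> Y closure_of (f ` A) = Y closure_of {y}"
    using assms Y f unfolding H_sober_closed_def H_sober_determined_def by blast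
  from theI'[OF this] show "ext Y f A \<in> topspace Y"
    "Y closure_of (f ` A) = Y closure_of {ext Y f A}"
    unfolding ext_def by auto
qed

lemma ext_in_iff:
  assumes "A \<in> D" "openin Y V"
  shows "ext Y f A \<in> V \<longleftrightarrow> f ` A \<inter> V \<noteq> {}"
proof -
  have "f ` A \<subseteq> topspace Y"
    using D_subset[OF assms(1)] f by (auto simp: continuous_map_def)
  then show ?thesis using ext[OF assms(1)] assms(2) by (simp add: closure_of_eq_sing_iff)
qed

lemma continuous_ext: "continuous_map S Y (ext Y f)"
  unfolding continuous_map_def
proof (intro conjI allI impI)
  show "ext Y f \<in> topspace S \<rightarrow> topspace Y" using ext by (auto simp: topspace_S)
  fix V assume V: "openin Y V"
  let ?U = "{x \<in> topspace X. f x \<in> V}"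
  have "{A \<in> topspace S. ext Y f A \<in> V} = dia ?U"
    using ext_in_iff[OF _ V] D_subset by (fastforce simp: topspace_S)
  then show "openin S {A \<in> topspace S. ext Y f A \<in> V}"
    using openin_dia[of ?U] f V by (simp add: continuous_map_def)
qed

end

abbreviation "pt x \<equiv> X closure_of {x}"

lemma pt_meets:
  assumes "x \<in> topspace X" "openin X U"
  shows "pt x \<inter> U \<noteq> {} \<longleftrightarrow> x \<in> U"
  using openin_Int_closure_of_eq_empty[OF assms(2), of "{x}"] by (auto simp: Int_commute)

lemma closure_image_pt:
  assumes "x \<in> topspace X" "continuous_map X Y f"
  shows "Y closure_of (f ` pt x) = Y closure_of {f x}"
proof (subst closure_of_eq_sing_iff)
  show "f ` pt x \<subseteq> topspace Y" "f x \<in> topspace Y"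
    using assms closure_of_subset_topspace[of X "{x}"] by (auto simp: continuous_map_def)
  show "\<forall>V. openin Y V \<longrightarrow> (f ` pt x \<inter> V \<noteq> {} \<longleftrightarrow> f x \<in> V)"
  proof (intro allI impI)
    fix V assume V: "openin Y V"
    let ?U = "{x \<in> topspace X. f x \<in> V}"
    have "openin X ?U" using assms V by (simp add: continuous_map_def)
    from pt_meets[OF assms(1) this] have "pt x \<inter> ?U \<noteq> {} \<longleftrightarrow> f x \<in> V"
      using assms by simp
    moreover have "pt x \<inter> ?U \<noteq> {} \<longleftrightarrow> f ` pt x \<inter> V \<noteq> {}"
      using closure_of_subset_topspace[of X "{x}"] by auto
    ultimately show "f ` pt x \<inter> V \<noteq> {} \<longleftrightarrow> f x \<in> V" by simp
  qed
qed

lemma pt_in_D: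
  assumes "x \<in> topspace X" shows "pt x \<in> D"
proof -
  have "H_sober_determined H X (pt x)"
  proof (rule H_sober_determinedI[OF closure_of_subset_topspace])
    fix Y f assume "H_sober H Y" and f: "continuous_map X Y f"
    have "f x \<in> topspace Y" using f assms by (auto simp: continuous_map_def)
    then show "\<exists>y \<in> topspace Y. Y closure_of (f ` pt x) = Y closure_of {y}"
      using closure_image_pt[OF assms f] by blast
  qed
  then show ?thesis by (simp add: H_sober_closed_def)
qed

lemma continuous_pt: "continuous_map X S pt"
proof (rule continuous_into_S)
  fix U assume U: "openin X U"
  then have "{x \<in> topspace X. pt x \<inter> U \<noteq> {}} = U"
    using pt_meets[OF _ U] openin_subset[OF U] by blast
  with U show "openin X {x \<in> topspace X. pt x \<inter> U \<noteq> {}}" by simp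
qed (rule pt_in_D)

lemma ext_pt:
  assumes "H_sober H Y" "continuous_map X Y f" "x \<in> topspace X"
  shows "ext Y f (pt x) = f x"
proof -
  note e = ext[OF assms(1,2) pt_in_D[OF assms(3)]]
  have "Y closure_of {ext Y f (pt x)} = Y closure_of {f x}"
    using e(2) closure_image_pt[OF assms(3,2)] by simp
  moreover have "f x \<in> topspace Y" using assms by (auto simp: continuous_map_def)
  moreover have "t0_space Y" using assms(1) by (simp add: H_sober_def)
  ultimately show ?thesis using e(1) t0_space_closure_sing_unique by metis
qed

lemma t0_S: "t0_space S"
  unfolding t0_space_def
proof (intro allI ballI impI)
  have *: "\<exists>U. openin S U \<and> (A \<notin> U) = (B \<in> U)"
    if "A \<in> D" "B \<in> D" "x \<in> A" "x \<notin> B" for A B x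
  proof -
    have "openin X (topspace X - B)" using that by (simp add: H_sober_closed_def closedin_def)
    then have "openin S (dia (topspace X - B))" by (rule openin_dia)
    moreover have "A \<in> dia (topspace X - B)" using that D_subset by blast
    moreover have "B \<notin> dia (topspace X - B)" by blast
    ultimately show ?thesis by blast
  qed
  fix A B assume "A \<in> topspace S" "B \<in> topspace S" "A \<noteq> B"
  then show "\<exists>U. openin S U \<and> (A \<notin> U) = (B \<in> U)"
    using *[of A B] *[of B A] unfolding topspace_S by blast
qed

lemma \<phi>: "continuous_map S Xh \<phi>" and \<psi>: "continuous_map Xh S \<psi>"
  and \<psi>\<phi>: "\<And>A. A \<in> D \<Longrightarrow> \<psi> (\<phi> A) = A" and \<phi>\<psi>: "\<And>u. u \<in> topspace Xh \<Longrightarrow> \<phi> (\<psi> u) = u"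
  using hom unfolding homeomorphic_maps_def topspace_S by auto

lemma \<phi>_in: "A \<in> D \<Longrightarrow> \<phi> A \<in> topspace Xh" and \<psi>_in: "u \<in> topspace Xh \<Longrightarrow> \<psi> u \<in> D"
  using \<phi> \<psi> unfolding continuous_map_def topspace_S by auto

lemma t0_Xh: "t0_space Xh"
  using t0_S hom homeomorphic_t0_space unfolding homeomorphic_space_def by blast

lemma openin_Xh_pullback: "openin Xh W \<Longrightarrow> openin S {A \<in> D. \<phi> A \<in> W}"
  using \<phi> unfolding continuous_map_def topspace_S by auto

lemma irreducible_meets:
  assumes "irreducible_in Z B" "openin Z V" "openin Z W" "B \<inter> V \<noteq> {}" "B \<inter> W \<noteq> {}"
  shows "B \<inter> (V \<inter> W) \<noteq> {}"
proof
  assume "B \<inter> (V \<inter> W) = {}"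
  moreover have "B \<subseteq> topspace Z" using assms(1) by (simp add: irreducible_in_def)
  ultimately have "B \<subseteq> (topspace Z - V) \<union> (topspace Z - W)" by blast
  moreover have "closedin Z (topspace Z - V)" "closedin Z (topspace Z - W)" using assms by auto
  ultimately have "B \<subseteq> topspace Z - V \<or> B \<subseteq> topspace Z - W"
    using assms(1) unfolding irreducible_in_def by blast
  then show False using assms by blast
qed

lemma sober_Xh: "H_sober H Xh"
proof (rule H_soberI[OF t0_Xh])
  fix B assume B: "B \<in> H Xh"
  have irr: "irreducible_in Xh B"
    using H t0_Xh B unfolding R_subset_system_def by blast
  then have Bsub: "B \<subseteq> topspace Xh" by (simp add: irreducible_in_def)
  let ?M = "\<Union> (\<psi> ` B)"
  define A where "A = X closure_of ?M"
  have Msub: "?M \<subseteq> topspace X" using Bsub \<psi>_in D_subset by blast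
  have Ameets: "A \<inter> U \<noteq> {} \<longleftrightarrow> (\<exists>b\<in>B. \<psi> b \<inter> U \<noteq> {})" if "openin X U" for U
    using openin_Int_closure_of_eq_empty[OF that, of ?M] unfolding A_def by blast
  have Asub: "A \<subseteq> topspace X" unfolding A_def by (rule closure_of_subset_topspace)
  have "H_sober_determined H X A"
  proof (rule H_sober_determinedI[OF Asub])
    fix Y f assume Y: "H_sober H Y" and f: "continuous_map X Y f"
    let ?g = "ext Y f \<circ> \<psi>"
    have g: "continuous_map Xh Y ?g"
      using continuous_map_compose[OF \<psi> continuous_ext[OF Y f]] .
    have tY: "t0_space Y" using Y by (simp add: H_sober_def)
    have "?g ` B \<in> H Y" using H t0_Xh tY g B unfolding R_subset_system_def by blast
    then obtain y where y: "y \<in> topspace Y" "Y closure_of (?g ` B) = Y closure_of {y}"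
      using Y unfolding H_sober_def by blast
    have gsub: "?g ` B \<subseteq> topspace Y" using g Bsub by (auto simp: continuous_map_def)
    have fsub: "f ` A \<subseteq> topspace Y" using f Asub by (auto simp: continuous_map_def)
    have "f ` A \<inter> V \<noteq> {} \<longleftrightarrow> y \<in> V" if V: "openin Y V" for V
    proof -
      let ?U = "{x \<in> topspace X. f x \<in> V}"
      have U: "openin X ?U" using f V by (simp add: continuous_map_def)
      have "f ` A \<inter> V \<noteq> {} \<longleftrightarrow> A \<inter> ?U \<noteq> {}" using Asub by blast
      also have "\<dots> \<longleftrightarrow> (\<exists>b\<in>B. \<psi> b \<inter> ?U \<noteq> {})" by (rule Ameets[OF U])
      also have "\<dots> \<longleftrightarrow> (\<exists>b\<in>B. f ` \<psi> b \<inter> V \<noteq> {})"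
      proof (rule bex_cong[OF refl])
        fix b assume "b \<in> B"
        then have "\<psi> b \<subseteq> topspace X" using Bsub \<psi>_in D_subset by blast
        then show "(\<psi> b \<inter> ?U \<noteq> {}) = (f ` \<psi> b \<inter> V \<noteq> {})" by blast
      qed
      also have "\<dots> \<longleftrightarrow> (\<exists>b\<in>B. ?g b \<in> V)"
        using ext_in_iff[OF Y f _ V] \<psi>_in Bsub by (metis comp_apply subsetD)
      also have "\<dots> \<longleftrightarrow> ?g ` B \<inter> V \<noteq> {}" by blast
      also have "\<dots> \<longleftrightarrow> y \<in> V"
        using y V closure_of_eq_sing_iff[OF gsub y(1)] by blast
      finally show ?thesis .
    qed
    then show "\<exists>y \<in> topspace Y. Y closure_of (f ` A) = Y closure_of {y}"
      using y(1) closure_of_eq_sing_iff[OF fsub y(1)] by blast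
  qed
  then have AD: "A \<in> D" by (simp add: H_sober_closed_def A_def)
  have sub: "\<psi> b \<subseteq> A" if "b \<in> B" for b
    using that closure_of_subset[OF Msub] unfolding A_def by blast
  have S_meets: "\<exists>b\<in>B. \<psi> b \<in> W" if "openin S W" "A \<in> W" for W
  proof -
    have "generate_topology_on {dia U |U. openin X U} W"
      using that(1) unfolding H_sober_closed_space_def by (rule openin_topology_generated_by)
    then show ?thesis using that(2)
    proof (induction W)
      case (Int W1 W2)
      let ?V = "\<lambda>W. {u \<in> topspace Xh. \<psi> u \<in> W}"
      have "openin S W1" "openin S W2"
        using Int.hyps unfolding H_sober_closed_space_def openin_topology_generated_by_iff .
      then have "openin Xh (?V W1)" "openin Xh (?V W2)"
        using \<psi> by (auto simp: continuous_map_def)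
      moreover have "B \<inter> ?V W1 \<noteq> {}" "B \<inter> ?V W2 \<noteq> {}" using Int Bsub by blast+
      ultimately have "B \<inter> (?V W1 \<inter> ?V W2) \<noteq> {}" using irr by (intro irreducible_meets)
      then show ?case by blast
    next
      case (UN K) then show ?case by blast
    next
      case (Basis W)
      then obtain U where U: "openin X U" "W = dia U" by blast
      have "A \<inter> U \<noteq> {}" using Basis.prems U(2) by simp
      then obtain b where b: "b \<in> B" "\<psi> b \<inter> U \<noteq> {}" using Ameets[OF U(1)] by blast
      moreover have "\<psi> b \<in> D" using \<psi>_in b(1) Bsub by blast
      ultimately show ?case unfolding U(2) by blast
    qed simp
  qed
  have "B \<inter> V \<noteq> {} \<longleftrightarrow> \<phi> A \<in> V" if V: "openin Xh V" for V
  proof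
    let ?W = "{A \<in> D. \<phi> A \<in> V}"
    have W: "openin S ?W" by (rule openin_Xh_pullback[OF V])
    {
      assume "B \<inter> V \<noteq> {}"
      then obtain b where b: "b \<in> B" "b \<in> V" by blast
      then have "\<psi> b \<in> ?W" using Bsub \<psi>_in \<phi>\<psi> by auto
      from up_closed[OF W this sub[OF b(1)] AD] show "\<phi> A \<in> V" by blast
    next
      assume "\<phi> A \<in> V"
      then obtain b where b: "b \<in> B" "\<psi> b \<in> ?W" using S_meets[OF W] AD by blast
      moreover have "\<phi> (\<psi> b) = b" using Bsub \<phi>\<psi> b(1) by blast
      ultimately have "b \<in> V" by simp
      then show "B \<inter> V \<noteq> {}" using b(1) by blast
    }
  qed
  then show "\<exists>x \<in> topspace Xh. Xh closure_of B = Xh closure_of {x}"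
    using \<phi>_in[OF AD] closure_of_eq_sing_iff[OF Bsub \<phi>_in[OF AD]] by blast
qed

lemma continuous_unit: "continuous_map X Xh (\<lambda>x. \<phi> (pt x))"
  using continuous_map_compose[OF continuous_pt \<phi>] by (simp add: comp_def)

lemma pt_dense:
  assumes A: "A \<in> D" and W: "openin S W" "A \<in> W"
  shows "\<exists>x\<in>A. pt x \<in> W"
proof -
  let ?\<mu> = "\<lambda>x. \<phi> (pt x)"
  note e = ext[OF sober_Xh continuous_unit A] and m = ext_in_iff[OF sober_Xh continuous_unit A]
  define C where "C = \<psi> (ext Xh ?\<mu> A)"
  have C: "C \<in> D" using e(1) \<psi>_in by (simp add: C_def)
  have pull: "openin Xh {u \<in> topspace Xh. \<psi> u \<in> T}" if "openin S T" for T
    using \<psi> that by (auto simp: continuous_map_def)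
  have CT: "C \<in> T \<longleftrightarrow> (\<exists>x\<in>A. pt x \<in> T)" if "openin S T" for T
  proof -
    have "C \<in> T \<longleftrightarrow> ?\<mu> ` A \<inter> {u \<in> topspace Xh. \<psi> u \<in> T} \<noteq> {}"
      using m[OF pull[OF that]] e(1) by (simp add: C_def)
    also have "\<dots> \<longleftrightarrow> (\<exists>x\<in>A. pt x \<in> T)"
    proof -
      have "?\<mu> x \<in> {u \<in> topspace Xh. \<psi> u \<in> T} \<longleftrightarrow> pt x \<in> T" if "x \<in> A" for x
        using that D_subset[OF A] \<phi>_in[OF pt_in_D] \<psi>\<phi>[OF pt_in_D] by auto
      moreover have "?\<mu> ` A \<inter> Z \<noteq> {} \<longleftrightarrow> (\<exists>x\<in>A. ?\<mu> x \<in> Z)" for Z by blast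
      ultimately show ?thesis by simp
    qed
    finally show ?thesis .
  qed
  have "C \<inter> U \<noteq> {} \<longleftrightarrow> A \<inter> U \<noteq> {}" if U: "openin X U" for U
    using CT[OF openin_dia[OF U]] C pt_in_D pt_meets[OF _ U] D_subset[OF A] by blast
  then have "X closure_of C = X closure_of A"
    using closure_of_eq_iff_meets D_subset A C by metis
  then have "C = A" using A C by (simp add: H_sober_closed_def closure_of_closedin)
  then show ?thesis using CT[OF W(1)] W(2) by simp
qed

theorem H_sobrification: "H_sobrification H X Xh (\<lambda>x. \<phi> (pt x))"
  unfolding H_sobrification_def
proof (intro conjI allI impI)
  show "H_sober H Xh" "continuous_map X Xh (\<lambda>x. \<phi> (pt x))"
    by (rule sober_Xh, rule continuous_unit)
  fix Y f assume "H_sober H Y \<and> continuous_map X Y f"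
  then have Y: "H_sober H Y" and f: "continuous_map X Y f" by auto
  have eq_ext: "g u = ext Y f (\<psi> u)"
    if g: "continuous_map Xh Y g" "\<forall>x \<in> topspace X. g (\<phi> (pt x)) = f x" and u: "u \<in> topspace Xh"
    for g u
  proof -
    define A where "A = \<psi> u"
    have A: "A \<in> D" "\<phi> A = u" using u \<psi>_in \<phi>\<psi> by (auto simp: A_def)
    have fsub: "f ` A \<subseteq> topspace Y" using f D_subset[OF A(1)] by (auto simp: continuous_map_def)
    have gu: "g u \<in> topspace Y" using g(1) u by (auto simp: continuous_map_def)
    have "f ` A \<inter> V \<noteq> {} \<longleftrightarrow> g u \<in> V" if V: "openin Y V" for V
    proof
      let ?W = "{A \<in> D. g (\<phi> A) \<in> V}"
      have "continuous_map S Y (g \<circ> \<phi>)" using continuous_map_compose[OF \<phi> g(1)] .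
      then have W: "openin S ?W" using V by (auto simp: continuous_map_def topspace_S)
      {
        assume "f ` A \<inter> V \<noteq> {}"
        then obtain x where x: "x \<in> A" "f x \<in> V" by blast
        have xX: "x \<in> topspace X" using x(1) A(1) D_subset by blast
        then have "pt x \<in> ?W" using g(2) x(2) pt_in_D by auto
        moreover have "pt x \<subseteq> A"
          using x(1) A(1) by (intro closure_of_minimal) (auto simp: H_sober_closed_def)
        ultimately have "A \<in> ?W" using up_closed[OF W] A(1) by blast
        then show "g u \<in> V" using A(2) by simp
      next
        assume "g u \<in> V"
        then have "A \<in> ?W" using A by simp
        from pt_dense[OF A(1) W this] obtain x where x: "x \<in> A" "pt x \<in> ?W" by blast
        then have "f x \<in> V" using g(2) D_subset[OF A(1)] by auto
        then show "f ` A \<inter> V \<noteq> {}" using x(1) by blast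
      }
    qed
    then have "Y closure_of (f ` A) = Y closure_of {g u}"
      using closure_of_eq_sing_iff[OF fsub gu] by blast
    then have "Y closure_of {g u} = Y closure_of {ext Y f A}"
      using ext(2)[OF Y f A(1)] by simp
    moreover have "t0_space Y" using Y by (simp add: H_sober_def)
    ultimately show ?thesis
      using t0_space_closure_sing_unique gu ext(1)[OF Y f A(1)] unfolding A_def by metis
  qed
  let ?g = "restrict (ext Y f \<circ> \<psi>) (topspace Xh)"
  have gc: "continuous_map Xh Y ?g"
    using continuous_map_compose[OF \<psi> continuous_ext[OF Y f]]
    by (rule continuous_map_eq) simp
  show "\<exists>!g. g \<in> extensional (topspace Xh) \<and> continuous_map Xh Y g \<and>
             (\<forall>x \<in> topspace X. g (\<phi> (pt x)) = f x)"
  proof (rule ex1I[of _ ?g])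
    show "?g \<in> extensional (topspace Xh) \<and> continuous_map Xh Y ?g \<and>
          (\<forall>x \<in> topspace X. ?g (\<phi> (pt x)) = f x)"
      using gc \<phi>_in[OF pt_in_D] \<psi>\<phi>[OF pt_in_D] ext_pt[OF Y f] by simp
  next
    fix g assume g: "g \<in> extensional (topspace Xh) \<and> continuous_map Xh Y g \<and>
          (\<forall>x \<in> topspace X. g (\<phi> (pt x)) = f x)"
    show "g = ?g"
    proof (rule extensionalityI[of _ "topspace Xh"])
      fix u assume "u \<in> topspace Xh"
      then show "g u = ?g u" using eq_ext[of g u] g by simp
    qed (use g in auto)
  qed
qed

end

theorem H_sobrification_realization:
  assumes "R_subset_system H" "t0_space X" "homeomorphic_map (H_sober_closed_space H X) Xh \<phi>"
  shows "H_sobrification H X Xh (\<lambda>x. \<phi> (X closure_of {x}))"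
proof -
  obtain \<psi> where "homeomorphic_maps (H_sober_closed_space H X) Xh \<phi> \<psi>"
    using assms(3) homeomorphic_map_maps by blast
  then interpret sober_realization H X Xh \<phi> \<psi> using assms by unfold_locales
  show ?thesis by (rule H_sobrification)
qed

corollary ex_H_sobrification:
  fixes X :: "'u topology" and e :: "'u set \<Rightarrow> 'u"
  assumes "R_subset_system H" "t0_space X" "inj_on e (Pow (topspace X))"
  shows "\<exists>Xh \<mu>. H_sobrification H X Xh \<mu>"
proof -
  let ?S = "H_sober_closed_space H X"
  have sub: "topspace ?S \<subseteq> Pow (topspace X)"
    unfolding H_sober_closed_space_def topology_generated_by_topspace H_sober_closed_def
    by (auto dest: closedin_subset)
  define e' where "e' = inv_into (topspace ?S) e"
  define Xh where "Xh = pullback_topology (e ` topspace ?S) e' ?S"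
  have inj: "inj_on e (topspace ?S)" using assms(3) sub inj_on_subset by blast
  have top: "topspace Xh = e ` topspace ?S"
    unfolding Xh_def topspace_pullback_topology using inj by (auto simp: e'_def)
  have "homeomorphic_maps ?S Xh e e'"
    unfolding homeomorphic_maps_def
  proof (intro conjI)
    have "continuous_map ?S ?S (e' \<circ> e)"
      using continuous_map_id by (rule continuous_map_eq) (simp add: e'_def inj)
    then show "continuous_map ?S Xh e"
      unfolding Xh_def by (rule continuous_map_pullback') auto
    show "continuous_map Xh ?S e'"
      unfolding Xh_def using continuous_map_pullback[OF continuous_map_id, of "e ` topspace ?S" e' ?S] by simp
  qed (auto simp: top e'_def inj f_inv_into_f)
  then have "homeomorphic_map ?S Xh e" using homeomorphic_map_maps by blast
  then show ?thesis using H_sobrification_realization assms by blast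
qed

end

theory Submission
  imports Defs
begin

text \<open>
  The unit of an \<open>H\<close>-sobrification is a quasihomeomorphism: taking preimages is a bijection between
  the open sets of the two spaces.  Indeed, open sets are continuous maps into the Sierpinski
  space, which is \<open>H\<close>-sober because every finite \<open>T\<^sub>0\<close> space is; existence and uniqueness of extensions
  give surjectivity and injectivity (\<open>sobrification_quasihomeo\<close>).  The argument uses
  only two points of the universe \<open>'u\<close>, so it holds even when the space of closed \<open>H\<close>-sober determined
  sets does not fit into \<open>'u\<close>; a one-point universe is treated separately.

  A finite product of quasihomeomorphisms is a quasihomeomorphism (\<open>quasihomeo_product\<close>), so
  continuous maps from \<open>\<Prod>Xh\<close> into a \<open>T\<^sub>0\<close> space are determined by their composites with
  \<open>M = \<Prod>\<mu>\<close>.  Moreover each continuous map from \<open>\<Prod>X\<close> to an \<open>H\<close>-sober space \<open>Y\<close> extends along \<open>M\<close>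
  (\<open>extend_over_product\<close>): the open sets of \<open>\<Prod>Xh\<close> already prescribe what the extension has to be, and
  the required points of \<open>Y\<close> are found by enlarging one coordinate at a time from \<open>X i\<close> to \<open>Xh i\<close>.

  With \<open>Y = Ph\<close> this gives \<open>\<Prod>Xh \<rightarrow> Ph\<close>.  The map \<open>Ph \<rightarrow> \<Prod>Xh\<close> comes from the universal property of \<open>Ph\<close>
  used in each coordinate; this way only spaces inside the universe are ever targets of an extension.
  The composite on \<open>\<Prod>Xh\<close> is the identity because it is so along the quasihomeomorphism \<open>M\<close>, and the
  composite on \<open>Ph\<close> because extensions to \<open>Ph\<close> are unique.
\<close>

section \<open>Quasihomeomorphisms\<close>

definition quasihomeo :: "'a topology \<Rightarrow> 'b topology \<Rightarrow> ('a \<Rightarrow> 'b) \<Rightarrow> bool" where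
  "quasihomeo X Y f \<longleftrightarrow> continuous_map X Y f \<and>
     bij_betw (\<lambda>W. {x \<in> topspace X. f x \<in> W}) {W. openin Y W} {U. openin X U}"

lemma quasihomeoI:
  assumes "continuous_map X Y f"
    and "\<And>U. openin X U \<Longrightarrow> \<exists>W. openin Y W \<and> (\<forall>x \<in> topspace X. f x \<in> W \<longleftrightarrow> x \<in> U)"
    and "\<And>W W'. \<lbrakk>openin Y W; openin Y W'; \<And>x. x \<in> topspace X \<Longrightarrow> f x \<in> W \<Longrightarrow> f x \<in> W'\<rbrakk> \<Longrightarrow> W \<subseteq> W'"
  shows "quasihomeo X Y f"
  unfolding quasihomeo_def bij_betw_def
proof (intro conjI)
  show "inj_on (\<lambda>W. {x \<in> topspace X. f x \<in> W}) {W. openin Y W}"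
    by (rule inj_onI) (use assms(3) in blast)
  show "(\<lambda>W. {x \<in> topspace X. f x \<in> W}) ` {W. openin Y W} = {U. openin X U}" (is "?l = ?r")
  proof
    show "?l \<subseteq> ?r" using assms(1) by (auto simp: continuous_map_def)
    show "?r \<subseteq> ?l"
    proof
      fix U assume "U \<in> ?r"
      then obtain W where "openin Y W" "\<forall>x \<in> topspace X. f x \<in> W \<longleftrightarrow> x \<in> U"
        using assms(2) by blast
      moreover have "U \<subseteq> topspace X" using \<open>U \<in> ?r\<close> openin_subset by blast
      ultimately have "openin Y W" "U = {x \<in> topspace X. f x \<in> W}" by auto
      then show "U \<in> ?l" by blast
    qed
  qed
qed (rule assms)

lemma quasihomeo_continuous: "quasihomeo X Y f \<Longrightarrow> continuous_map X Y f"
  by (simp add: quasihomeo_def)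

lemma quasihomeo_lift:
  assumes "quasihomeo X Y f" "openin X U"
  obtains W where "openin Y W" "\<And>x. x \<in> topspace X \<Longrightarrow> f x \<in> W \<longleftrightarrow> x \<in> U"
proof -
  have "U \<in> (\<lambda>W. {x \<in> topspace X. f x \<in> W}) ` {W. openin Y W}"
    using assms by (simp add: quasihomeo_def bij_betw_def)
  then show thesis using that by blast
qed

lemma quasihomeo_open_eq:
  assumes "quasihomeo X Y f" "openin Y W" "openin Y W'"
    and "\<And>x. x \<in> topspace X \<Longrightarrow> f x \<in> W \<longleftrightarrow> f x \<in> W'"
  shows "W = W'"
proof -
  have "inj_on (\<lambda>W. {x \<in> topspace X. f x \<in> W}) {W. openin Y W}"
    using assms(1) by (simp add: quasihomeo_def bij_betw_def)
  moreover have "{x \<in> topspace X. f x \<in> W} = {x \<in> topspace X. f x \<in> W'}" using assms(4) by blast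
  ultimately show ?thesis using assms(2,3) by (simp add: inj_on_def)
qed

lemma quasihomeo_open_mono:
  assumes "quasihomeo X Y f" "openin Y W" "openin Y W'"
    and "\<And>x. x \<in> topspace X \<Longrightarrow> f x \<in> W \<Longrightarrow> f x \<in> W'"
  shows "W \<subseteq> W'"
  using quasihomeo_open_eq[OF assms(1) openin_Int[OF assms(2,3)] assms(2)] assms(4) by blast

lemma t0_space_eqI:
  assumes "t0_space Y" "y \<in> topspace Y" "z \<in> topspace Y"
    and "\<And>V. openin Y V \<Longrightarrow> y \<in> V \<longleftrightarrow> z \<in> V"
  shows "y = z"
  using assms unfolding t0_space_def by blast

text \<open>
  Equality of two points in a \<open>T\<^sub>0\<close> space is tested on open sets, and the preimages of an open set under
  the two maps are open sets of \<open>Y\<close> with the same trace on \<open>X\<close>.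
\<close>

lemma quasihomeo_epi:
  assumes f: "quasihomeo X Y f" and Z: "t0_space Z"
    and g: "continuous_map Y Z g" and h: "continuous_map Y Z h"
    and eq: "\<And>x. x \<in> topspace X \<Longrightarrow> g (f x) = h (f x)" and y: "y \<in> topspace Y"
  shows "g y = h y"
proof (rule t0_space_eqI[OF Z])
  show "g y \<in> topspace Z" "h y \<in> topspace Z" using g h y by (auto simp: continuous_map_def)
  fix V assume V: "openin Z V"
  have "{y \<in> topspace Y. g y \<in> V} = {y \<in> topspace Y. h y \<in> V}"
    by (rule quasihomeo_open_eq[OF f]) (use g h V eq in \<open>auto simp: continuous_map_def\<close>)
  then show "g y \<in> V \<longleftrightarrow> h y \<in> V" using y by blast
qed

text \<open>
  Every point \<open>u\<close> is approximated from below, in the specialization order, by points of the image: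
  otherwise the open set \<open>B\<close> and its part outside the closure of \<open>u\<close> would have the same preimage.
\<close>

lemma quasihomeo_approx:
  assumes f: "quasihomeo X Y f" and B: "openin Y B" and u: "u \<in> B"
  obtains x where "x \<in> topspace X" "f x \<in> B" "\<And>C. openin Y C \<Longrightarrow> f x \<in> C \<Longrightarrow> u \<in> C"
proof -
  let ?N = "topspace Y - Y closure_of {u}"
  have uY: "u \<in> topspace Y" using B u openin_subset by blast
  have "\<exists>x \<in> topspace X. f x \<in> B \<and> f x \<in> Y closure_of {u}"
  proof (rule ccontr)
    assume "\<not> ?thesis"
    moreover have "f x \<in> topspace Y" if "x \<in> topspace X" for x
      using that quasihomeo_continuous[OF f] by (auto simp: continuous_map_def)
    ultimately have "B \<subseteq> ?N" by (intro quasihomeo_open_mono[OF f B]) auto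
    moreover have "u \<in> Y closure_of {u}" using uY closure_of_subset[of "{u}" Y] by blast
    ultimately show False using u by blast
  qed
  then show thesis using that unfolding in_closure_of by blast
qed

text \<open>
  Open sets lift because boxes do.  For injectivity, a point \<open>u\<close> of a box inside \<open>W\<close> is approximated
  from below in each coordinate by an image point in the same box; that image point lies in \<open>W'\<close>,
  and open sets are upward closed.
\<close>

lemma quasihomeo_product:
  assumes I: "finite I" and q: "\<And>i. i \<in> I \<Longrightarrow> quasihomeo (X i) (Y i) (f i)"
  shows "quasihomeo (product_topology X I) (product_topology Y I) (\<lambda>x. \<lambda>i\<in>I. f i (x i))"
    (is "quasihomeo ?X ?Y ?f")
proof (rule quasihomeoI)
  show "continuous_map ?X ?Y ?f"
    unfolding continuous_map_componentwise
  proof (intro conjI ballI)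
    fix i assume i: "i \<in> I"
    have "continuous_map ?X (Y i) (f i \<circ> (\<lambda>x. x i))"
      using continuous_map_compose[OF continuous_map_product_projection[of i _ X, OF i]
          quasihomeo_continuous[OF q[OF i]]] .
    then show "continuous_map ?X (Y i) (\<lambda>x. ?f x i)" using i by (simp add: comp_def)
  qed auto
next
  have box: "openin ?Y (Pi\<^sub>E I B)" if "\<And>i. i \<in> I \<Longrightarrow> openin (Y i) (B i)" for B
    using that I by (simp add: openin_PiE)
  fix U assume U: "openin ?X U"
  let ?K = "{Pi\<^sub>E I B | B. (\<forall>i\<in>I. openin (Y i) (B i)) \<and>
               (\<forall>x \<in> topspace ?X. ?f x \<in> Pi\<^sub>E I B \<longrightarrow> x \<in> U)}"
  have "openin ?Y (\<Union>?K)" using box by (intro openin_Union) blast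
  moreover have "?f x \<in> \<Union>?K \<longleftrightarrow> x \<in> U" if x: "x \<in> topspace ?X" for x
  proof
    assume "?f x \<in> \<Union>?K"
    then obtain B where "?f x \<in> Pi\<^sub>E I B" "\<forall>x \<in> topspace ?X. ?f x \<in> Pi\<^sub>E I B \<longrightarrow> x \<in> U"
      by (elim UnionE CollectE exE conjE) (simp only:)
    then show "x \<in> U" using x by (meson bspec)
  next
    assume "x \<in> U"
    then obtain A where A: "\<And>i. i \<in> I \<Longrightarrow> openin (X i) (A i)" "x \<in> Pi\<^sub>E I A" "Pi\<^sub>E I A \<subseteq> U"
      using U unfolding openin_product_topology_alt by metis
    have "\<forall>i\<in>I. \<exists>W. openin (Y i) W \<and> (\<forall>z \<in> topspace (X i). f i z \<in> W \<longleftrightarrow> z \<in> A i)"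
      using quasihomeo_lift[OF q A(1)] by metis
    then obtain B where B: "\<And>i. i \<in> I \<Longrightarrow> openin (Y i) (B i)"
      "\<And>i z. i \<in> I \<Longrightarrow> z \<in> topspace (X i) \<Longrightarrow> f i z \<in> B i \<longleftrightarrow> z \<in> A i" by metis
    have *: "?f z \<in> Pi\<^sub>E I B \<longleftrightarrow> z \<in> Pi\<^sub>E I A" if "z \<in> topspace ?X" for z
      using that B(2) by (auto simp: PiE_iff)
    then have "\<forall>z \<in> topspace ?X. ?f z \<in> Pi\<^sub>E I B \<longrightarrow> z \<in> U" using A(3) by (meson subsetD)
    with B(1) have "Pi\<^sub>E I B \<in> ?K" by (intro CollectI exI[of _ B] conjI ballI refl) auto
    moreover have "?f x \<in> Pi\<^sub>E I B" using *[OF x] A(2) by (rule iffD2)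
    ultimately show "?f x \<in> \<Union>?K" by (rule UnionI)
  qed
  ultimately show "\<exists>W. openin ?Y W \<and> (\<forall>x \<in> topspace ?X. ?f x \<in> W \<longleftrightarrow> x \<in> U)"
    by (intro exI[of _ "\<Union>?K"] conjI ballI)
next
  fix W W' assume W: "openin ?Y W" and W': "openin ?Y W'"
    and sub: "\<And>x. x \<in> topspace ?X \<Longrightarrow> ?f x \<in> W \<Longrightarrow> ?f x \<in> W'"
  show "W \<subseteq> W'"
  proof
    fix u assume "u \<in> W"
    then obtain B where B: "\<And>i. i \<in> I \<Longrightarrow> openin (Y i) (B i)" "u \<in> Pi\<^sub>E I B" "Pi\<^sub>E I B \<subseteq> W"
      using W unfolding openin_product_topology_alt by metis
    have "\<exists>z. z \<in> topspace (X i) \<and> f i z \<in> B i \<and> (\<forall>C. openin (Y i) C \<longrightarrow> f i z \<in> C \<longrightarrow> u i \<in> C)"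
      if "i \<in> I" for i
      using quasihomeo_approx[OF q[OF that] B(1)[OF that] PiE_mem[OF B(2) that]] by metis
    then obtain z where z: "\<And>i. i \<in> I \<Longrightarrow> z i \<in> topspace (X i)" "\<And>i. i \<in> I \<Longrightarrow> f i (z i) \<in> B i"
      "\<And>i C. i \<in> I \<Longrightarrow> openin (Y i) C \<Longrightarrow> f i (z i) \<in> C \<Longrightarrow> u i \<in> C" by metis
    let ?x = "restrict z I"
    have "?x \<in> topspace ?X" using z(1) by auto
    moreover have "?f ?x \<in> Pi\<^sub>E I B" using z(2) by auto
    ultimately have "?f ?x \<in> W'" using sub[of ?x] B(3) by (meson subsetD)
    then obtain C where C: "\<And>i. i \<in> I \<Longrightarrow> openin (Y i) (C i)" "?f ?x \<in> Pi\<^sub>E I C" "Pi\<^sub>E I C \<subseteq> W'"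
      using W' unfolding openin_product_topology_alt by metis
    have "u i \<in> C i" if "i \<in> I" for i
      using z(3)[OF that C(1)[OF that]] PiE_mem[OF C(2) that] that by simp
    then have "u \<in> Pi\<^sub>E I C" using B(2) by (auto simp: PiE_iff)
    then show "u \<in> W'" using C(3) by blast
  qed
qed

section \<open>The unit of an H-sobrification\<close>

lemma irreducible_in_finite_Union:
  assumes "irreducible_in X A" "finite K" "\<And>C. C \<in> K \<Longrightarrow> closedin X C" "A \<subseteq> \<Union>K"
  shows "\<exists>C\<in>K. A \<subseteq> C"
  using assms(2-4)
proof (induction K)
  case empty
  then show ?case using assms(1) by (simp add: irreducible_in_def)
next
  case (insert C K)
  have "closedin X (\<Union>K)" using insert by (intro closedin_Union) auto
  then have "A \<subseteq> C \<or> A \<subseteq> \<Union>K"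
    using assms(1) insert.prems unfolding irreducible_in_def by (metis Union_insert insertI1)
  then show ?case using insert by blast
qed

text \<open>
  A finite irreducible set is contained in the closure of one of its points, since it is covered
  by the closures of all of them.
\<close>

lemma finite_t0_space_H_sober:
  assumes H: "R_subset_system H" and X: "t0_space X" and fin: "finite (topspace X)"
  shows "H_sober H X"
proof (rule H_soberI[OF X])
  fix A assume "A \<in> H X"
  then have irr: "irreducible_in X A" using H X unfolding R_subset_system_def by blast
  then have A: "A \<subseteq> topspace X" by (simp add: irreducible_in_def)
  have "\<exists>C \<in> (\<lambda>a. X closure_of {a}) ` A. A \<subseteq> C"
  proof (rule irreducible_in_finite_Union[OF irr])
    show "A \<subseteq> \<Union> ((\<lambda>a. X closure_of {a}) ` A)"
      using A closure_of_subset[of "{_}" X] by blast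
  qed (use A fin finite_subset in auto)
  then obtain a where a: "a \<in> A" "A \<subseteq> X closure_of {a}" by blast
  have "X closure_of A = X closure_of {a}"
    using a by (simp add: closure_of_minimal closure_of_mono subset_antisym)
  then show "\<exists>x \<in> topspace X. X closure_of A = X closure_of {x}" using a A by blast
qed

definition sierpinski :: "'a \<Rightarrow> 'a \<Rightarrow> 'a topology" where
  "sierpinski a b = topology (\<lambda>U. U = {} \<or> U = {a} \<or> U = {a, b})"

lemma openin_sierpinski: "openin (sierpinski a b) U \<longleftrightarrow> U = {} \<or> U = {a} \<or> U = {a, b}"
proof -
  have "istopology (\<lambda>U. U = {} \<or> U = {a} \<or> U = {a, b})"
    unfolding istopology_def
  proof (intro conjI allI impI)
    fix K assume K: "\<forall>U\<in>K. U = {} \<or> U = {a} \<or> U = {a, b}"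
    show "\<Union>K = {} \<or> \<Union>K = {a} \<or> \<Union>K = {a, b}"
    proof (cases "{a, b} \<in> K")
      case True
      with K have "\<Union>K = {a, b}" by blast
      then show ?thesis by blast
    next
      case False
      with K have "\<Union>K \<subseteq> {a}" by blast
      then show ?thesis by blast
    qed
  qed auto
  then show ?thesis unfolding sierpinski_def by (simp add: topology_inverse')
qed

lemma topspace_sierpinski: "topspace (sierpinski a b) = {a, b}"
  unfolding topspace_def openin_sierpinski by blast

lemma t0_space_sierpinski: "t0_space (sierpinski a b)"
  unfolding t0_space_def topspace_sierpinski openin_sierpinski by blast

lemma continuous_map_sierpinski:
  assumes "a \<noteq> b"
  shows "continuous_map X (sierpinski a b) f \<longleftrightarrow>
           f \<in> topspace X \<rightarrow> {a, b} \<and> openin X {x \<in> topspace X. f x = a}"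
proof
  assume f: "continuous_map X (sierpinski a b) f"
  have "openin (sierpinski a b) {a}" by (simp add: openin_sierpinski)
  from openin_continuous_map_preimage[OF f this] have "openin X {x \<in> topspace X. f x = a}" by simp
  then show "f \<in> topspace X \<rightarrow> {a, b} \<and> openin X {x \<in> topspace X. f x = a}"
    using f by (simp add: continuous_map_def topspace_sierpinski)
next
  assume f: "f \<in> topspace X \<rightarrow> {a, b} \<and> openin X {x \<in> topspace X. f x = a}"
  then have "{x \<in> topspace X. f x \<in> {a, b}} = topspace X" by blast
  then show "continuous_map X (sierpinski a b) f"
    using f by (auto simp: continuous_map_def topspace_sierpinski openin_sierpinski
        simp del: insert_iff) auto
qed

lemma H_sobrification_extend:
  assumes "H_sobrification H X Xh \<mu>" "H_sober H Y" "continuous_map X Y f"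
  obtains g where "continuous_map Xh Y g" "\<And>x. x \<in> topspace X \<Longrightarrow> g (\<mu> x) = f x"
  using assms unfolding H_sobrification_def by metis

lemma H_sobrification_unique:
  assumes "H_sobrification H X Xh \<mu>" "H_sober H Y"
    and "continuous_map Xh Y g" "continuous_map Xh Y h"
    and "\<And>x. x \<in> topspace X \<Longrightarrow> g (\<mu> x) = h (\<mu> x)" "u \<in> topspace Xh"
  shows "g u = h u"
proof -
  have \<mu>: "continuous_map X Xh \<mu>" using assms(1) by (simp add: H_sobrification_def)
  then have in_Xh: "\<mu> x \<in> topspace Xh" if "x \<in> topspace X" for x
    using that by (auto simp: continuous_map_def)
  have "continuous_map X Y (g \<circ> \<mu>)" using continuous_map_compose[OF \<mu> assms(3)] .
  then have ex1: "\<exists>!k. k \<in> extensional (topspace Xh) \<and> continuous_map Xh Y k \<and>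
      (\<forall>x \<in> topspace X. k (\<mu> x) = (g \<circ> \<mu>) x)"
    using assms(1,2) unfolding H_sobrification_def by blast
  have "continuous_map Xh Y (restrict g (topspace Xh))" "continuous_map Xh Y (restrict h (topspace Xh))"
    using assms(3,4) by (auto intro: continuous_map_eq)
  then have "restrict g (topspace Xh) = restrict h (topspace Xh)"
    using ex1 in_Xh assms(5) by (metis (no_types, lifting) comp_apply restrict_apply' restrict_extensional)
  then show ?thesis using assms(6) by (metis restrict_apply')
qed

text \<open>
  An open set of \<open>X\<close> is a map to the Sierpinski space; the open set belonging to its extension to \<open>Xh\<close>
  is the lift.  Two open sets of \<open>Xh\<close> with the same trace on \<open>X\<close> give two extensions of the same map.
\<close>

lemma sobrification_quasihomeo:
  fixes H :: "'u topology \<Rightarrow> 'u set set"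
  assumes H: "R_subset_system H" and X: "t0_space X" and s: "H_sobrification H X Xh \<mu>"
  shows "quasihomeo X Xh \<mu>"
proof (cases "\<exists>a b :: 'u. a \<noteq> b")
  case True
  then obtain a b :: 'u where ab: "a \<noteq> b" by blast
  let ?S = "sierpinski a b"
  have S: "H_sober H ?S"
    by (rule finite_t0_space_H_sober[OF H t0_space_sierpinski]) (simp add: topspace_sierpinski)
  have chi: "continuous_map Z ?S (\<lambda>z. if z \<in> U then a else b)" if "openin Z U" for Z :: "'u topology" and U
  proof -
    have "{z \<in> topspace Z. (if z \<in> U then a else b) = a} = U"
      using openin_subset[OF that] ab by auto
    then show ?thesis using that by (simp add: continuous_map_sierpinski[OF ab] Pi_iff)
  qed
  show ?thesis
  proof (rule quasihomeoI)
    show \<mu>: "continuous_map X Xh \<mu>" using s by (simp add: H_sobrification_def)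
    fix U assume "openin X U"
    then obtain g where g: "continuous_map Xh ?S g"
      "\<And>x. x \<in> topspace X \<Longrightarrow> g (\<mu> x) = (if x \<in> U then a else b)"
      using H_sobrification_extend[OF s S chi] by metis
    let ?W = "{u \<in> topspace Xh. g u = a}"
    have "openin Xh ?W" using g(1) by (simp add: continuous_map_sierpinski[OF ab])
    moreover have "\<forall>x \<in> topspace X. \<mu> x \<in> ?W \<longleftrightarrow> x \<in> U"
      using g(2) \<mu> ab by (auto simp: continuous_map_def)
    ultimately show "\<exists>W. openin Xh W \<and> (\<forall>x \<in> topspace X. \<mu> x \<in> W \<longleftrightarrow> x \<in> U)" by blast
  next
    fix W W' assume W: "openin Xh W" and W': "openin Xh W'"
      and sub: "\<And>x. x \<in> topspace X \<Longrightarrow> \<mu> x \<in> W \<Longrightarrow> \<mu> x \<in> W'"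
    show "W \<subseteq> W'"
    proof
      fix u assume u: "u \<in> W"
      then have "u \<in> topspace Xh" using W openin_subset by blast
      have "(if u \<in> W \<inter> W' then a else b) = (if u \<in> W then a else b)"
        by (rule H_sobrification_unique[OF s S chi chi]) (use W W' sub \<open>u \<in> topspace Xh\<close> in auto)
      then show "u \<in> W'" using u ab by (auto split: if_splits)
    qed
  qed
next
  \<comment> \<open>A one-point universe has no Sierpinski space.  All maps on it are the identity, so only an
    empty \<open>X\<close> with a nonempty \<open>Xh\<close> could go wrong; but \<open>Xh\<close> maps to \<open>X\<close>, which is \<open>H\<close>-sober.\<close>
  case False
  then have eq: "x = y" for x y :: 'u by blast
  have \<mu>: "continuous_map X Xh \<mu>" using s by (simp add: H_sobrification_def)
  have "finite (topspace X)" using eq by (metis finite.simps finite_subset insertI1 subsetI)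
  then have "H_sober H X" by (rule finite_t0_space_H_sober[OF H X])
  then obtain g where g: "continuous_map Xh X g"
    using H_sobrification_extend[OF s _ continuous_map_id] by blast
  have same: "u \<in> topspace X" if "u \<in> topspace Xh" for u
    proof -
    have "g u \<in> topspace X" using that g unfolding continuous_map_def by blast
    then show ?thesis by (metis eq)
  qed
  show ?thesis
  proof (rule quasihomeoI[OF \<mu>])
    fix U assume U: "openin X U"
    have "U = {} \<or> U = topspace X" using openin_subset[OF U] eq by (metis equals0I subsetI subset_antisym)
    then show "\<exists>W. openin Xh W \<and> (\<forall>x \<in> topspace X. \<mu> x \<in> W \<longleftrightarrow> x \<in> U)"
      using \<mu> by (metis (no_types, lifting) Pi_iff continuous_map_def empty_iff openin_empty openin_topspace)
  next
    fix W W' assume W: "openin Xh W"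
      and sub: "\<And>x. x \<in> topspace X \<Longrightarrow> \<mu> x \<in> W \<Longrightarrow> \<mu> x \<in> W'"
    show "W \<subseteq> W'"
    proof
      fix u assume u: "u \<in> W"
      then have "u \<in> topspace X" using W openin_subset same by blast
      from sub[OF this] show "u \<in> W'" using u eq[of "\<mu> u" u] by simp
    qed
  qed
qed

section \<open>Extending maps over a finite product of sobrifications\<close>

text \<open>
  Write \<open>T V\<close> for the open set of \<open>\<Prod>Xh\<close> that restricts to the preimage of \<open>V\<close>.  An extension must
  send \<open>u\<close> to a point whose open neighbourhoods are the \<open>V\<close> with \<open>u \<in> T V\<close>; any choice of
  such points is automatically continuous.  The point exists if all coordinates of \<open>u\<close> come from the
  \<open>X i\<close>.  To free the coordinate \<open>j\<close>, the points already found for \<open>u(j := \<mu> j x)\<close> form a continuous map of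
  \<open>x \<in> X j\<close>, and its extension to \<open>Xh j\<close> has the right neighbourhoods because open sets of \<open>Xh j\<close> are
  determined by their traces on \<open>X j\<close>.
\<close>

lemma extend_over_product:
  assumes I: "finite I" and s: "\<And>i. i \<in> I \<Longrightarrow> H_sobrification H (X i) (Xh i) (\<mu> i)"
    and q: "\<And>i. i \<in> I \<Longrightarrow> quasihomeo (X i) (Xh i) (\<mu> i)"
    and Y: "H_sober H Y" and f: "continuous_map (product_topology X I) Y f"
  obtains g where "continuous_map (product_topology Xh I) Y g"
    "\<And>x. x \<in> topspace (product_topology X I) \<Longrightarrow> g (\<lambda>i\<in>I. \<mu> i (x i)) = f x"
proof -
  let ?X = "product_topology X I" and ?Xh = "product_topology Xh I"
  let ?M = "\<lambda>x. \<lambda>i\<in>I. \<mu> i (x i)"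
  have M: "quasihomeo ?X ?Xh ?M" by (rule quasihomeo_product[OF I q])
  have "\<forall>V \<in> {V. openin Y V}. \<exists>W. openin ?Xh W \<and> (\<forall>x \<in> topspace ?X. ?M x \<in> W \<longleftrightarrow> f x \<in> V)"
  proof
    fix V assume "V \<in> {V. openin Y V}"
    then have "openin ?X {x \<in> topspace ?X. f x \<in> V}" using f by (simp add: continuous_map_def)
    from quasihomeo_lift[OF M this] obtain W where W: "openin ?Xh W"
      "\<And>x. x \<in> topspace ?X \<Longrightarrow> ?M x \<in> W \<longleftrightarrow> x \<in> {x \<in> topspace ?X. f x \<in> V}" by blast
    have "?M x \<in> W \<longleftrightarrow> f x \<in> V" if "x \<in> topspace ?X" for x
      using W(2)[OF that] that unfolding mem_Collect_eq by blast
    with W(1) show "\<exists>W. openin ?Xh W \<and> (\<forall>x \<in> topspace ?X. ?M x \<in> W \<longleftrightarrow> f x \<in> V)" by blast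
  qed
  from bchoice[OF this] obtain T where
    "\<forall>V \<in> {V. openin Y V}. openin ?Xh (T V) \<and> (\<forall>x \<in> topspace ?X. ?M x \<in> T V \<longleftrightarrow> f x \<in> V)" ..
  then have T: "\<And>V. openin Y V \<Longrightarrow> openin ?Xh (T V)"
    "\<And>V x. openin Y V \<Longrightarrow> x \<in> topspace ?X \<Longrightarrow> ?M x \<in> T V \<longleftrightarrow> f x \<in> V" by blast+
  have "\<exists>y \<in> topspace Y. \<forall>V. openin Y V \<longrightarrow> (y \<in> V \<longleftrightarrow> u \<in> T V)"
    if "J \<subseteq> I" "u \<in> topspace ?Xh" "\<And>i. i \<in> I - J \<Longrightarrow> u i \<in> \<mu> i ` topspace (X i)" for J u
    using finite_subset[OF that(1) I] that
  proof (induction J arbitrary: u)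
    case empty
    have "\<forall>i\<in>I. \<exists>x. x \<in> topspace (X i) \<and> u i = \<mu> i x" using empty.prems(3) by blast
    then obtain x where x: "\<And>i. i \<in> I \<Longrightarrow> x i \<in> topspace (X i)" "\<And>i. i \<in> I \<Longrightarrow> u i = \<mu> i (x i)"
      by metis
    let ?x = "restrict x I"
    have x': "?x \<in> topspace ?X" using x(1) by auto
    have "?M ?x = u"
      using x(2) empty.prems(2) by (intro extensionalityI[of _ I]) (auto simp: PiE_iff)
    then have "f ?x \<in> V \<longleftrightarrow> u \<in> T V" if "openin Y V" for V using T(2)[OF that x'] by simp
    moreover have "f ?x \<in> topspace Y" using f x' unfolding continuous_map_def by blast
    ultimately show ?case by blast
  next
    case (insert j J)
    have j: "j \<in> I" using insert.prems by blast
    have upd: "continuous_map (Xh j) ?Xh (\<lambda>v. u(j := v))"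
      unfolding continuous_map_componentwise
    proof (intro conjI ballI)
      show "(\<lambda>v. u(j := v)) ` topspace (Xh j) \<subseteq> extensional I"
        using insert.prems(2) j by (auto simp: PiE_iff extensional_def)
      fix i assume i: "i \<in> I"
      show "continuous_map (Xh j) (Xh i) (\<lambda>v. (u(j := v)) i)"
        using insert.prems(2) i by (cases "i = j") (auto simp: PiE_iff)
    qed
    have \<mu>j: "continuous_map (X j) (Xh j) (\<mu> j)" by (rule quasihomeo_continuous[OF q[OF j]])
    have "\<exists>y \<in> topspace Y. \<forall>V. openin Y V \<longrightarrow> (y \<in> V \<longleftrightarrow> u(j := \<mu> j x) \<in> T V)"
      if x: "x \<in> topspace (X j)" for x
    proof (rule insert.IH)
      show "J \<subseteq> I" using insert.prems by blast
      show "u(j := \<mu> j x) \<in> topspace ?Xh" using upd \<mu>j x by (auto simp only: continuous_map_def Pi_iff)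
      fix i assume "i \<in> I - J"
      then show "(u(j := \<mu> j x)) i \<in> \<mu> i ` topspace (X i)" using insert.prems(3) x by auto
    qed
    then obtain p where p: "\<And>x. x \<in> topspace (X j) \<Longrightarrow> p x \<in> topspace Y"
      "\<And>x V. x \<in> topspace (X j) \<Longrightarrow> openin Y V \<Longrightarrow> p x \<in> V \<longleftrightarrow> u(j := \<mu> j x) \<in> T V" by metis
    have "continuous_map (X j) Y p"
      unfolding continuous_map_def
    proof (intro conjI allI impI)
      fix V assume V: "openin Y V"
      have "continuous_map (X j) ?Xh (\<lambda>x. u(j := \<mu> j x))"
        using continuous_map_compose[OF \<mu>j upd] by (simp add: comp_def)
      from openin_continuous_map_preimage[OF this T(1)[OF V]]
      show "openin (X j) {x \<in> topspace (X j). p x \<in> V}"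
        using p(2)[OF _ V] by (simp cong: conj_cong)
    qed (use p in auto)
    then obtain g where g: "continuous_map (Xh j) Y g" "\<And>x. x \<in> topspace (X j) \<Longrightarrow> g (\<mu> j x) = p x"
      using H_sobrification_extend[OF s[OF j] Y] by metis
    have uj: "u j \<in> topspace (Xh j)" using insert.prems(2) j by auto
    have "g (u j) \<in> V \<longleftrightarrow> u \<in> T V" if V: "openin Y V" for V
    proof -
      have "{v \<in> topspace (Xh j). g v \<in> V} = {v \<in> topspace (Xh j). u(j := v) \<in> T V}"
        by (rule quasihomeo_open_eq[OF q[OF j] openin_continuous_map_preimage[OF g(1) V]
              openin_continuous_map_preimage[OF upd T(1)[OF V]]])
          (use g(2) p(2)[OF _ V] in auto)
      then have "g (u j) \<in> V \<longleftrightarrow> u(j := u j) \<in> T V" using uj by blast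
      then show ?thesis by simp
    qed
    moreover have "g (u j) \<in> topspace Y" using g(1) uj by (auto simp: continuous_map_def)
    ultimately show ?case by blast
  qed
  from this[OF subset_refl]
  have "\<exists>y. y \<in> topspace Y \<and> (\<forall>V. openin Y V \<longrightarrow> (y \<in> V \<longleftrightarrow> u \<in> T V))"
    if "u \<in> topspace ?Xh" for u
    using that by (simp add: Bex_def)
  then obtain g where g: "\<And>u. u \<in> topspace ?Xh \<Longrightarrow> g u \<in> topspace Y"
    "\<And>u V. u \<in> topspace ?Xh \<Longrightarrow> openin Y V \<Longrightarrow> g u \<in> V \<longleftrightarrow> u \<in> T V" by metis
  show thesis
  proof (rule that[of g])
    show "continuous_map ?Xh Y g"
      unfolding continuous_map_def
    proof (intro conjI allI impI)
      fix V assume V: "openin Y V"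
      have "{u \<in> topspace ?Xh. g u \<in> V} = T V"
        using g(2)[OF _ V] openin_subset[OF T(1)[OF V]] by blast
      then show "openin ?Xh {u \<in> topspace ?Xh. g u \<in> V}" using T(1)[OF V] by simp
    qed (use g in blast)
    fix x assume x: "x \<in> topspace ?X"
    have Mx: "?M x \<in> topspace ?Xh"
      using quasihomeo_continuous[OF M] x unfolding continuous_map_def by blast
    show "g (?M x) = f x"
    proof (rule t0_space_eqI)
      show "t0_space Y" using Y by (simp add: H_sober_def)
      show "g (?M x) \<in> topspace Y" using g(1)[OF Mx] .
      show "f x \<in> topspace Y" using f x unfolding continuous_map_def by blast
      fix V assume "openin Y V"
      then show "g (?M x) \<in> V \<longleftrightarrow> f x \<in> V" using g(2)[OF Mx] T(2)[OF _ x] by simp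
    qed
  qed
qed

section \<open>Sobrification commutes with finite products\<close>

theorem corollary7p24:
  fixes H :: "'u topology \<Rightarrow> 'u set set"
    and n :: nat
    and X Xh :: "nat \<Rightarrow> 'u topology"
    and \<mu> :: "nat \<Rightarrow> 'u \<Rightarrow> 'u"
    and P Ph :: "'u topology"
    and \<nu> :: "'u \<Rightarrow> 'u"
  assumes "R_subset_system H"
    and "\<And>i. i \<in> {1..n} \<Longrightarrow> t0_space (X i)"
    and "P homeomorphic_space product_topology X {1..n}"
    and "\<And>i. i \<in> {1..n} \<Longrightarrow> H_sobrification H (X i) (Xh i) (\<mu> i)"
    and "H_sobrification H P Ph \<nu>"
  shows "Ph homeomorphic_space product_topology Xh {1..n}"
proof -
  let ?I = "{1..n}"
  let ?X = "product_topology X ?I" and ?Xh = "product_topology Xh ?I"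
  let ?M = "\<lambda>x. \<lambda>i\<in>?I. \<mu> i (x i)"
  obtain h k where h: "continuous_map P ?X h" and k: "continuous_map ?X P k"
    and kh: "\<And>p. p \<in> topspace P \<Longrightarrow> k (h p) = p" and hk: "\<And>x. x \<in> topspace ?X \<Longrightarrow> h (k x) = x"
    using assms(3) unfolding homeomorphic_space_def homeomorphic_maps_def by blast
  have h_in: "h p \<in> topspace ?X" if "p \<in> topspace P" for p
    using h that unfolding continuous_map_def by blast
  have k_in: "k x \<in> topspace P" if "x \<in> topspace ?X" for x
    using k that unfolding continuous_map_def by blast
  have q: "quasihomeo (X i) (Xh i) (\<mu> i)" if "i \<in> ?I" for i
    by (rule sobrification_quasihomeo[OF assms(1,2,4)]) (fact that)+
  have M: "quasihomeo ?X ?Xh ?M" by (rule quasihomeo_product[OF _ q]) auto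
  have sober_Xh: "H_sober H (Xh i)" if "i \<in> ?I" for i
    using assms(4)[OF that] by (simp add: H_sobrification_def)
  have sober_Ph: "H_sober H Ph" and \<nu>: "continuous_map P Ph \<nu>"
    using assms(5) by (simp_all add: H_sobrification_def)
  obtain a where a: "continuous_map ?Xh Ph a" "\<And>x. x \<in> topspace ?X \<Longrightarrow> a (?M x) = \<nu> (k x)"
  proof (rule extend_over_product[OF _ assms(4) q sober_Ph continuous_map_compose[OF k \<nu>]])
    fix g assume "continuous_map ?Xh Ph g" "\<And>x. x \<in> topspace ?X \<Longrightarrow> g (?M x) = (\<nu> \<circ> k) x"
    then show thesis by (intro that) (simp_all only: comp_apply)
  qed simp
  have "\<exists>g. continuous_map Ph (Xh i) g \<and> (\<forall>p \<in> topspace P. g (\<nu> p) = \<mu> i (h p i))"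
    if i: "i \<in> ?I" for i
  proof -
    have "continuous_map P (Xh i) (\<mu> i \<circ> ((\<lambda>x. x i) \<circ> h))"
      by (intro continuous_map_compose[OF _ quasihomeo_continuous[OF q[OF i]]]
          continuous_map_compose[OF h continuous_map_product_projection[of i _ X, OF i]])
    then show ?thesis using H_sobrification_extend[OF assms(5) sober_Xh[OF i]] by (metis comp_apply)
  qed
  then obtain b where b: "\<And>i. i \<in> ?I \<Longrightarrow> continuous_map Ph (Xh i) (b i)"
    "\<And>i p. i \<in> ?I \<Longrightarrow> p \<in> topspace P \<Longrightarrow> b i (\<nu> p) = \<mu> i (h p i)" by metis
  let ?b = "\<lambda>y. \<lambda>i\<in>?I. b i y"
  have b_cont: "continuous_map Ph ?Xh ?b"
    unfolding continuous_map_componentwise using b(1) by auto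
  have b\<nu>: "?b (\<nu> p) = ?M (h p)" if "p \<in> topspace P" for p
    using b(2)[OF _ that] by (auto intro: restrict_ext)
  have "t0_space ?Xh"
    using sober_Xh by (auto simp: t0_space_product_topology H_sober_def)
  have ba: "?b (a u) = u" if "u \<in> topspace ?Xh" for u
  proof -
    have "(?b \<circ> a) u = id u"
    proof (rule quasihomeo_epi[OF M \<open>t0_space ?Xh\<close>, where g = "?b \<circ> a" and h = id])
      fix x assume x: "x \<in> topspace ?X"
      show "(?b \<circ> a) (?M x) = id (?M x)"
        using a(2)[OF x] b\<nu>[OF k_in[OF x]] hk[OF x] by simp
    qed (use continuous_map_compose[OF a(1) b_cont] that in auto)
    then show ?thesis by simp
  qed
  have ab: "a (?b y) = y" if "y \<in> topspace Ph" for y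
  proof -
    have "(a \<circ> ?b) y = id y"
    proof (rule H_sobrification_unique[OF assms(5) sober_Ph, where g = "a \<circ> ?b" and h = id])
      fix p assume p: "p \<in> topspace P"
      show "(a \<circ> ?b) (\<nu> p) = id (\<nu> p)"
        using b\<nu>[OF p] a(2)[OF h_in[OF p]] kh[OF p] by simp
    qed (use continuous_map_compose[OF b_cont a(1)] that in auto)
    then show ?thesis by simp
  qed
  show ?thesis
    unfolding homeomorphic_space_def homeomorphic_maps_def
    using a(1) b_cont ab ba by blast
qed

end
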